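(* Let $\alpha$ be a countable ordinal. Let $(Y,d)$ be a metric space and let $(X,\mathcal{T}(X))$, $(Z,\mathcal{T}(Z))$ be two perfectly normal topological spaces. Let $\mathcal{T}(Y)$ be a topology on $Y$ which is finer than the topology induced by $d$ and such that $(Y,\mathcal{T}(Y))$ is separable. Let $S$ be a countable $\mathcal{T}(Y)$-dense subset of $Y$. Suppose that to every point $v\in Y$ there corresponds a subset $U(v)\in\mathcal{T}(Y)$ such that (i) for every $y\in S$, the set $B(y)=\{v\in Y: y\in U(v)\}$ belongs to $\Sigma_\alpha(Y,d)$; and (ii) for every $v\in Y$, the family $\mathcal{N}(v)=\{U(v)\cap B(v,2^{-n}): n=1,2,\ldots\}$, where $B(v,2^{-n})$ denotes the open $d$-ball centered at $v$ with radius $2^{-n}$, forms a filterbase of $\mathcal{T}(Y)$-neighbourhoods of the point $v$. Let $F:X\times Y\to Z$ be a multivalued function such that every $y$-section $F^{y}$ ($y\in Y$) is of $\mathcal{T}(X)$-upper Borel class $\alpha$ and every $x$-section $F_x$ ($x\in X$) is $\mathcal{T}(Y)$-continuous. Then $F$ is of lower Borel class $\alpha+1$ on the product of the topological spaces $(X,\mathcal{T}(X))$ and $(Y,d)$.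
   Context: A multivalued function $\Phi:T\to Z$ assigns to each $t\in T$ a nonempty subset $\Phi(t)\subset Z$. For $G\subset Z$ put $\Phi^+(G)=\{t\in T:\Phi(t)\subset G\}$ and $\Phi^-(G)=\{t\in T:\Phi(t)\cap G\neq\emptyset\}$. Let $(T,\mathcal{T}(T))$ and $(Z,\mathcal{T}(Z))$ be topological spaces. $\Phi$ is $\mathcal{T}(T)$-upper (resp. $\mathcal{T}(T)$-lower) semicontinuous if $\Phi^+(G)\in\mathcal{T}(T)$ (resp. $\Phi^-(G)\in\mathcal{T}(T)$) for every $G\in\mathcal{T}(Z)$; it is $\mathcal{T}(T)$-continuous if it is both $\mathcal{T}(T)$-upper and $\mathcal{T}(T)$-lower semicontinuous. For a countable ordinal $\alpha$, $\Sigma_\alpha(T)$ and $\Pi_\alpha(T)$ denote the additive and multiplicative class $\alpha$ in the Borel hierarchy of $(T,\mathcal{T}(T))$, indexed from $0$: $\Sigma_0(T)$ is the family of open sets, $\Pi_\alpha(T)$ consists of the complements of members of $\Sigma_\alpha(T)$, and for $\alpha>0$, $\Sigma_\alpha(T)$ consists of countable unions of members of $\bigcup_{\beta<\alpha}\Pi_\beta(T)$. $\Sigma_\alpha(Y,d)$ refers to the metric topology of $(Y,d)$. $\Phi$ is of $\mathcal{T}(T)$-lower (resp. $\mathcal{T}(T)$-upper) Borel class $\alpha$ if $\Phi^-(G)\in\Sigma_\alpha(T)$ (resp. $\Phi^+(G)\in\Sigma_\alpha(T)$) for every $G\in\mathcal{T}(Z)$. For a multivalued function $F:X\times Y\to Z$,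 the $x$-section is $F_x:Y\to Z$, $F_x(y)=F(x,y)$, and the $y$-section is $F^y:X\to Z$, $F^y(x)=F(x,y)$. "Filterbase of $\mathcal{T}(Y)$-neighbourhoods of $v$" means a local base at $v$: its members are $\mathcal{T}(Y)$-neighbourhoods of $v$, and every $\mathcal{T}(Y)$-neighbourhood of $v$ contains one of them. *)

theory Defs
  imports "HOL-Analysis.Analysis" "HOL-Library.Countable_Set_Type"
begin

text \<open>The type of all countable ordinals, that is, the first uncountable ordinal
  \<open>\<omega>\<^sub>1\<close> regarded as a well-ordered set. Up to isomorphism it is the only well-order
  that is uncountable and all of whose proper initial segments are countable.\<close>

typedef countable_ordinal = "Field (cardSuc natLeq)"
proof -
  have "infinite (Field (cardSuc natLeq))"
    using cardSuc_finite[OF natLeq_Card_order] by (simp add: Field_natLeq)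
  then show ?thesis
    by (metis ex_in_conv finite.emptyI)
qed

lemma cardSuc_natLeq_Well_order: "Well_order (cardSuc natLeq)"
  using cardSuc_Card_order[OF natLeq_Card_order] by (simp add: card_order_on_def)

instantiation countable_ordinal :: wellorder
begin

definition less_eq_countable_ordinal :: "countable_ordinal \<Rightarrow> countable_ordinal \<Rightarrow> bool" where
  "\<alpha> \<le> \<beta> \<longleftrightarrow> (Rep_countable_ordinal \<alpha>, Rep_countable_ordinal \<beta>) \<in> cardSuc natLeq"

definition less_countable_ordinal :: "countable_ordinal \<Rightarrow> countable_ordinal \<Rightarrow> bool" where
  "\<alpha> < \<beta> \<longleftrightarrow> \<alpha> \<le> \<beta> \<and> \<alpha> \<noteq> (\<beta> :: countable_ordinal)"

instance
proof
  note wo = cardSuc_natLeq_Well_order[unfolded well_order_on_def linear_order_on_def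
      partial_order_on_def preorder_on_def]
  note R = Rep_countable_ordinal
  fix \<alpha> \<beta> \<gamma> :: countable_ordinal
  show refl: "\<alpha> \<le> \<alpha>"
    using wo R[of \<alpha>] by (auto simp: less_eq_countable_ordinal_def refl_on_def)
  show "\<alpha> \<le> \<beta> \<Longrightarrow> \<beta> \<le> \<gamma> \<Longrightarrow> \<alpha> \<le> \<gamma>"
    using wo unfolding less_eq_countable_ordinal_def trans_def by blast
  show antisym: "\<alpha> \<le> \<beta> \<Longrightarrow> \<beta> \<le> \<alpha> \<Longrightarrow> \<alpha> = \<beta>"
    using wo unfolding less_eq_countable_ordinal_def antisym_def
    by (metis Rep_countable_ordinal_inject)
  show "\<alpha> < \<beta> \<longleftrightarrow> \<alpha> \<le> \<beta> \<and> \<not> \<beta> \<le> \<alpha>"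
    using refl antisym by (auto simp: less_countable_ordinal_def)
  show "\<alpha> \<le> \<beta> \<or> \<beta> \<le> \<alpha>"
    using wo R[of \<alpha>] R[of \<beta>] refl
    unfolding less_eq_countable_ordinal_def total_on_def
    by (metis Rep_countable_ordinal_inject)
next
  fix P :: "countable_ordinal \<Rightarrow> bool" and \<alpha>
  assume step: "\<And>\<alpha>. (\<And>\<beta>. \<beta> < \<alpha> \<Longrightarrow> P \<beta>) \<Longrightarrow> P \<alpha>"
  have "wf (inv_image (cardSuc natLeq - Id) Rep_countable_ordinal)"
    using cardSuc_natLeq_Well_order by (auto simp: well_order_on_def)
  then show "P \<alpha>"
  proof (induction \<alpha> rule: wf_induct_rule)
    case (less \<alpha>)
    show ?case
      by (rule step, rule less)
        (auto simp: less_countable_ordinal_def less_eq_countable_ordinal_def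
          Rep_countable_ordinal_inject)
  qed
qed

end

lemma uncountable_UNIV_countable_ordinal: "uncountable (UNIV :: countable_ordinal set)"
proof
  include cardinal_syntax
  assume "countable (UNIV :: countable_ordinal set)"
  then have "countable (Field (cardSuc natLeq))"
    by (metis countable_image type_definition.Rep_range type_definition_countable_ordinal)
  then have "|Field (cardSuc natLeq)| \<le>o natLeq"
    by (simp add: countable_card_le_natLeq)
  then have "cardSuc natLeq \<le>o natLeq"
    using card_of_Field_ordIso[OF cardSuc_Card_order[OF natLeq_Card_order]]
    by (metis ordIso_ordLeq_trans ordIso_symmetric)
  then show False
    using cardSuc_greater[OF natLeq_Card_order] not_ordLess_ordLeq by blast
qed

lemma countable_lessThan_countable_ordinal: "countable {..<\<alpha> :: countable_ordinal}"
proof -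
  include cardinal_syntax
  let ?r = "cardSuc natLeq" and ?a = "Rep_countable_ordinal \<alpha>"
  have "|underS ?r ?a| <o ?r"
    using card_of_underS[OF cardSuc_Card_order[OF natLeq_Card_order]] Rep_countable_ordinal
    by blast
  then have "|underS ?r ?a| \<le>o natLeq"
    using cardSuc_ordLeq_ordLess[OF natLeq_Card_order card_of_Card_order] by blast
  then have "countable (underS ?r ?a)"
    by (simp add: countable_card_le_natLeq)
  moreover have "Rep_countable_ordinal ` {..<\<alpha>} \<subseteq> underS ?r ?a"
    by (auto simp: underS_def less_countable_ordinal_def less_eq_countable_ordinal_def
        Rep_countable_ordinal_inject)
  ultimately show ?thesis
    by (metis countable_subset countable_image_inj_on inj_onI Rep_countable_ordinal_inject)
qed

definition ord_suc :: "countable_ordinal \<Rightarrow> countable_ordinal" where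
  "ord_suc \<alpha> = (LEAST \<beta>. \<alpha> < \<beta>)"

lemma less_ord_suc: "\<alpha> < ord_suc \<alpha>"
proof -
  have "\<exists>\<beta>. \<alpha> < \<beta>"
  proof (rule ccontr)
    assume "\<not> ?thesis"
    then have "UNIV = insert \<alpha> {..<\<alpha>}"
      by (auto simp: not_less order_le_less)
    then show False
      by (metis countable_insert countable_lessThan_countable_ordinal
          uncountable_UNIV_countable_ordinal)
  qed
  then show ?thesis
    unfolding ord_suc_def by (rule LeastI_ex)
qed

lemma less_ord_suc_iff: "\<beta> < ord_suc \<alpha> \<longleftrightarrow> \<beta> \<le> \<alpha>"
  by (metis less_ord_suc not_less_Least not_less ord_suc_def order_le_less_trans)

text \<open>\<open>Sigma_class T \<alpha>\<close> is the additive class \<open>\<alpha>\<close> and \<open>Pi_class T \<alpha>\<close> the multiplicative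
  class \<open>\<alpha>\<close>, where class \<open>0\<close> (the least ordinal) consists of the open, respectively closed,
  sets. The condition \<open>\<forall>\<beta>. \<alpha> \<le> \<beta>\<close> says that \<open>\<alpha>\<close> is \<open>0\<close>. The recursion spells
  out \<open>Pi_class\<close>, which is defined afterwards; \<open>Sigma_class_zero\<close> and \<open>Sigma_class_pos\<close>
  are the usual defining equations. Since the empty set belongs to multiplicative class \<open>0\<close>,
  unions of sequences cover all countable unions.\<close>

function Sigma_class :: "'a topology \<Rightarrow> countable_ordinal \<Rightarrow> 'a set set" where
  "Sigma_class T \<alpha> =
     (if \<forall>\<beta>. \<alpha> \<le> \<beta> then {G. openin T G}
      else {\<Union>n. A n |A :: nat \<Rightarrow> 'a set.
              \<forall>n. \<exists>\<beta>\<in>{..<\<alpha>}. \<exists>B\<in>Sigma_class T \<beta>. A n = topspace T - B})"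
  by pat_completeness auto
termination
  by (relation "inv_image {(\<alpha>, \<beta>). \<alpha> < \<beta>} snd") (auto intro: wf)

declare Sigma_class.simps [simp del]

definition Pi_class :: "'a topology \<Rightarrow> countable_ordinal \<Rightarrow> 'a set set" where
  "Pi_class T \<alpha> = {topspace T - B |B. B \<in> Sigma_class T \<alpha>}"

lemma Sigma_class_zero:
  assumes "\<And>\<beta>. \<alpha> \<le> \<beta>"
  shows "Sigma_class T \<alpha> = {G. openin T G}"
  using assms by (subst Sigma_class.simps) simp

lemma Sigma_class_pos:
  assumes "\<gamma> < \<alpha>"
  shows "Sigma_class T \<alpha> = {\<Union>n. A n |A :: nat \<Rightarrow> _. \<forall>n. A n \<in> (\<Union>\<beta>\<in>{..<\<alpha>}. Pi_class T \<beta>)}"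
proof -
  have "\<not> (\<forall>\<beta>. \<alpha> \<le> \<beta>)"
    using assms not_less by blast
  then show ?thesis
    by (subst Sigma_class.simps) (simp only: if_False Pi_class_def UN_iff mem_Collect_eq Bex_def conj_commute)
qed

text \<open>As for \<open>normal_space\<close>, no separation axiom \<open>T\<^sub>1\<close> is included.\<close>

definition perfectly_normal_space :: "'a topology \<Rightarrow> bool" where
  "perfectly_normal_space T \<longleftrightarrow> normal_space T \<and> (\<forall>C. closedin T C \<longrightarrow> gdelta_in T C)"

definition nbhd :: "'a topology \<Rightarrow> 'a \<Rightarrow> 'a set \<Rightarrow> bool" where
  "nbhd T v N \<longleftrightarrow> N \<subseteq> topspace T \<and> (\<exists>G. openin T G \<and> v \<in> G \<and> G \<subseteq> N)"

definition local_base :: "'a topology \<Rightarrow> 'a \<Rightarrow> 'a set set \<Rightarrow> bool" where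
  "local_base T v \<N> \<longleftrightarrow>
     (\<forall>N\<in>\<N>. nbhd T v N) \<and> (\<forall>W. nbhd T v W \<longrightarrow> (\<exists>N\<in>\<N>. N \<subseteq> W))"

definition multivalued :: "'t set \<Rightarrow> 'z set \<Rightarrow> ('t \<Rightarrow> 'z set) \<Rightarrow> bool" where
  "multivalued A Z \<Phi> \<longleftrightarrow> (\<forall>t\<in>A. \<Phi> t \<noteq> {} \<and> \<Phi> t \<subseteq> Z)"

definition upper_inverse :: "'t set \<Rightarrow> ('t \<Rightarrow> 'z set) \<Rightarrow> 'z set \<Rightarrow> 't set" where
  "upper_inverse A \<Phi> G = {t\<in>A. \<Phi> t \<subseteq> G}"

definition lower_inverse :: "'t set \<Rightarrow> ('t \<Rightarrow> 'z set) \<Rightarrow> 'z set \<Rightarrow> 't set" where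
  "lower_inverse A \<Phi> G = {t\<in>A. \<Phi> t \<inter> G \<noteq> {}}"

definition upper_semicontinuous :: "'t topology \<Rightarrow> 'z topology \<Rightarrow> ('t \<Rightarrow> 'z set) \<Rightarrow> bool" where
  "upper_semicontinuous T Z \<Phi> \<longleftrightarrow>
     (\<forall>G. openin Z G \<longrightarrow> openin T (upper_inverse (topspace T) \<Phi> G))"

definition lower_semicontinuous :: "'t topology \<Rightarrow> 'z topology \<Rightarrow> ('t \<Rightarrow> 'z set) \<Rightarrow> bool" where
  "lower_semicontinuous T Z \<Phi> \<longleftrightarrow>
     (\<forall>G. openin Z G \<longrightarrow> openin T (lower_inverse (topspace T) \<Phi> G))"

definition continuous_multi :: "'t topology \<Rightarrow> 'z topology \<Rightarrow> ('t \<Rightarrow> 'z set) \<Rightarrow> bool" where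
  "continuous_multi T Z \<Phi> \<longleftrightarrow> upper_semicontinuous T Z \<Phi> \<and> lower_semicontinuous T Z \<Phi>"

definition upper_Borel_class ::
    "'t topology \<Rightarrow> 'z topology \<Rightarrow> countable_ordinal \<Rightarrow> ('t \<Rightarrow> 'z set) \<Rightarrow> bool" where
  "upper_Borel_class T Z \<alpha> \<Phi> \<longleftrightarrow>
     (\<forall>G. openin Z G \<longrightarrow> upper_inverse (topspace T) \<Phi> G \<in> Sigma_class T \<alpha>)"

definition lower_Borel_class ::
    "'t topology \<Rightarrow> 'z topology \<Rightarrow> countable_ordinal \<Rightarrow> ('t \<Rightarrow> 'z set) \<Rightarrow> bool" where
  "lower_Borel_class T Z \<alpha> \<Phi> \<longleftrightarrow>
     (\<forall>G. openin Z G \<longrightarrow> lower_inverse (topspace T) \<Phi> G \<in> Sigma_class T \<alpha>)"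

end

theory Submission
  imports Defs
begin

text \<open>
  A closed set \<open>K\<close> of the perfectly normal space \<open>Z\<close> is the intersection of a decreasing
  sequence of open sets \<open>V n\<close> whose closures have the same intersection. Since the sections
  \<open>F\<^sub>x\<close> are continuous, \<open>F (x, v) \<subseteq> K\<close> holds iff for every \<open>n\<close> there is a point \<open>y\<close> of the
  countable set \<open>S\<close> with \<open>y \<in> U v\<close>, \<open>d v y < 2\<^sup>-\<^sup>n\<close> and \<open>F (x, y) \<subseteq> V n\<close>: upper semicontinuity
  and density of \<open>S\<close> give such points, and conversely such points \<open>y\<^sub>n\<close> converge to \<open>v\<close> in the
  finer topology, so lower semicontinuity at \<open>v\<close> applies. For fixed \<open>n\<close> and \<open>y\<close> these
  conditions define a rectangle whose sides are of additive class \<open>\<alpha>\<close>, so the set of all such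
  \<open>(x, v)\<close> is a countable intersection of sets of additive class \<open>\<alpha>\<close>.
\<close>

section \<open>Closure properties of the Borel classes in arbitrary topological spaces\<close>

lemma countable_ordinal_zero:
  obtains \<zeta> :: countable_ordinal where "\<And>\<beta>. \<zeta> \<le> \<beta>"
  by (rule that[of "LEAST \<beta>. True"]) (simp add: Least_le)

text \<open>Covers the empty index set in \<open>Sigma_class_countable_UN\<close>; in the theorem it
  occurs when \<open>Y\<close>, and with it \<open>S\<close>, is empty.\<close>

lemma empty_in_Sigma_class: "{} \<in> Sigma_class T \<alpha>"
proof (cases "\<forall>\<beta>. \<alpha> \<le> \<beta>")
  case True
  then show ?thesis
    by (simp add: Sigma_class_zero)
next
  case False
  obtain \<zeta> :: countable_ordinal where \<zeta>: "\<And>\<beta>. \<zeta> \<le> \<beta>"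
    by (rule countable_ordinal_zero) blast
  then have "\<zeta> < \<alpha>"
    using False by (meson leD leI order_trans)
  moreover have "{} \<in> Pi_class T \<zeta>"
    unfolding Pi_class_def Sigma_class_zero[OF \<zeta>] by (auto intro!: exI[of _ "topspace T"])
  ultimately show ?thesis
    unfolding Sigma_class_pos[OF \<open>\<zeta> < \<alpha>\<close>] by (auto intro!: exI[of _ "\<lambda>_. {}"])
qed

lemma Sigma_class_subset_topspace:
  assumes "A \<in> Sigma_class T \<alpha>"
  shows "A \<subseteq> topspace T"
proof (cases "\<forall>\<beta>. \<alpha> \<le> \<beta>")
  case True
  then show ?thesis
    using assms openin_subset by (auto simp: Sigma_class_zero)
next
  case False
  then obtain \<gamma> where "\<gamma> < \<alpha>"
    using not_less by blast
  then obtain B where "A = (\<Union>n. B n)" "\<And>n :: nat. B n \<in> (\<Union>\<beta>\<in>{..<\<alpha>}. Pi_class T \<beta>)"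
    using assms by (auto simp: Sigma_class_pos)
  then show ?thesis
    unfolding Pi_class_def by blast
qed

lemma Pi_class_subset_Sigma_class:
  assumes "\<beta> < \<alpha>"
  shows "Pi_class T \<beta> \<subseteq> Sigma_class T \<alpha>"
proof
  fix A
  assume "A \<in> Pi_class T \<beta>"
  then show "A \<in> Sigma_class T \<alpha>"
    unfolding Sigma_class_pos[OF assms] using assms by (auto intro!: exI[of _ "\<lambda>_. A"])
qed

lemma Sigma_class_UN_nat:
  assumes "\<And>n :: nat. A n \<in> Sigma_class T \<alpha>"
  shows "(\<Union>n. A n) \<in> Sigma_class T \<alpha>"
proof (cases "\<forall>\<beta>. \<alpha> \<le> \<beta>")
  case True
  then show ?thesis
    using assms by (auto simp: Sigma_class_zero)
next
  case False
  then obtain \<gamma> where \<gamma>: "\<gamma> < \<alpha>"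
    using not_less by blast
  have "\<exists>B :: nat \<Rightarrow> _. A n = (\<Union>m. B m) \<and> (\<forall>m. B m \<in> (\<Union>\<beta>\<in>{..<\<alpha>}. Pi_class T \<beta>))" for n
    using assms[of n] unfolding Sigma_class_pos[OF \<gamma>] by blast
  then obtain B :: "nat \<Rightarrow> nat \<Rightarrow> _" where B: "\<And>n. A n = (\<Union>m. B n m)"
    "\<And>n m. B n m \<in> (\<Union>\<beta>\<in>{..<\<alpha>}. Pi_class T \<beta>)"
    by metis
  \<comment> \<open>The pairing bijection flattens the double family into a single sequence, the
    shape that \<open>Sigma_class_pos\<close> asks for.\<close>
  define C where "C k = B (fst (prod_decode k)) (snd (prod_decode k))" for k
  have "(\<Union>n. A n) = (\<Union>k. C k)"
  proof
    have "B n m \<subseteq> (\<Union>k. C k)" for n m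
      using UN_upper[of "prod_encode (n, m)" UNIV C] by (simp add: C_def)
    then show "(\<Union>n. A n) \<subseteq> (\<Union>k. C k)"
      by (auto simp: B(1))
    show "(\<Union>k. C k) \<subseteq> (\<Union>n. A n)"
      by (auto simp: B(1) C_def)
  qed
  moreover have "C k \<in> (\<Union>\<beta>\<in>{..<\<alpha>}. Pi_class T \<beta>)" for k
    unfolding C_def by (rule B(2))
  ultimately show ?thesis
    unfolding Sigma_class_pos[OF \<gamma>] by blast
qed

lemma Sigma_class_countable_UN:
  assumes "countable I" and "\<And>i. i \<in> I \<Longrightarrow> A i \<in> Sigma_class T \<alpha>"
  shows "(\<Union>i\<in>I. A i) \<in> Sigma_class T \<alpha>"
proof (cases "I = {}")
  case True
  then show ?thesis
    by (simp add: empty_in_Sigma_class)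
next
  case False
  \<comment> \<open>\<open>from_nat_into I\<close> maps the naturals onto the nonempty set
    \<open>I\<close>, with repetitions if \<open>I\<close> is finite.\<close>
  have "(\<Union>i\<in>I. A i) = (\<Union>n. A (from_nat_into I n))"
    using range_from_nat_into[OF False assms(1)] by (metis image_image)
  then show ?thesis
    using Sigma_class_UN_nat[of "\<lambda>n. A (from_nat_into I n)"] assms(2) from_nat_into[OF False]
    by simp
qed

lemma Sigma_class_Un:
  assumes "A \<in> Sigma_class T \<alpha>" and "B \<in> Sigma_class T \<alpha>"
  shows "A \<union> B \<in> Sigma_class T \<alpha>"
  using Sigma_class_countable_UN[of "{True, False}" "\<lambda>b. if b then A else B" T \<alpha>] assms
  by (auto simp: Un_commute)

lemma Pi_class_Int:
  assumes "A \<in> Pi_class T \<alpha>" and "B \<in> Pi_class T \<alpha>"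
  shows "A \<inter> B \<in> Pi_class T \<alpha>"
proof -
  obtain A' B' where "A' \<in> Sigma_class T \<alpha>" "A = topspace T - A'"
    "B' \<in> Sigma_class T \<alpha>" "B = topspace T - B'"
    using assms unfolding Pi_class_def by blast
  then show ?thesis
    unfolding Pi_class_def using Sigma_class_Un by blast
qed

text \<open>Transfinite induction on \<alpha>: preimages commute with unions and, because
  \<open>f\<close> maps \<open>topspace T\<close> into \<open>topspace T'\<close>, also with
  complements relative to the two spaces.\<close>

lemma Sigma_class_preimage:
  assumes f: "continuous_map T T' f" and "A \<in> Sigma_class T' \<alpha>"
  shows "{x \<in> topspace T. f x \<in> A} \<in> Sigma_class T \<alpha>"
  using assms(2)
proof (induction \<alpha> arbitrary: A rule: less_induct)
  case (less \<alpha>)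
  show ?case
  proof (cases "\<forall>\<beta>. \<alpha> \<le> \<beta>")
    case True
    then show ?thesis
      using less.prems openin_continuous_map_preimage[OF f] by (simp add: Sigma_class_zero)
  next
    case False
    then obtain \<gamma> where \<gamma>: "\<gamma> < \<alpha>"
      using not_less by blast
    obtain B where B: "A = (\<Union>n. B n)" "\<And>n :: nat. B n \<in> (\<Union>\<beta>\<in>{..<\<alpha>}. Pi_class T' \<beta>)"
      using less.prems unfolding Sigma_class_pos[OF \<gamma>] by blast
    have "{x \<in> topspace T. f x \<in> B n} \<in> Sigma_class T \<alpha>" for n
    proof -
      obtain \<beta> C where \<beta>: "\<beta> < \<alpha>" "C \<in> Sigma_class T' \<beta>" "B n = topspace T' - C"
        using B(2)[of n] unfolding Pi_class_def by auto
      have "{x \<in> topspace T. f x \<in> B n} = topspace T - {x \<in> topspace T. f x \<in> C}"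
        using f \<beta>(3) by (auto simp: continuous_map_def)
      then have "{x \<in> topspace T. f x \<in> B n} \<in> Pi_class T \<beta>"
        using less.IH[OF \<beta>(1,2)] unfolding Pi_class_def by blast
      then show ?thesis
        using Pi_class_subset_Sigma_class[OF \<beta>(1)] by blast
    qed
    moreover have "{x \<in> topspace T. f x \<in> A} = (\<Union>n. {x \<in> topspace T. f x \<in> B n})"
      using B(1) by blast
    ultimately show ?thesis
      by (simp add: Sigma_class_UN_nat)
  qed
qed

lemma Pi_class_preimage:
  assumes f: "continuous_map T T' f" and "A \<in> Pi_class T' \<alpha>"
  shows "{x \<in> topspace T. f x \<in> A} \<in> Pi_class T \<alpha>"
proof -
  obtain C where C: "C \<in> Sigma_class T' \<alpha>" "A = topspace T' - C"
    using assms(2) unfolding Pi_class_def by blast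
  have "{x \<in> topspace T. f x \<in> A} = topspace T - {x \<in> topspace T. f x \<in> C}"
    using f C(2) by (auto simp: continuous_map_def)
  then show ?thesis
    using Sigma_class_preimage[OF f C(1)] unfolding Pi_class_def by blast
qed

section \<open>Borel classes and spaces whose closed sets are G-delta\<close>

lemma open_in_Sigma_class:
  assumes gdelta: "\<And>C. closedin T C \<Longrightarrow> gdelta_in T C" and G: "openin T G"
  shows "G \<in> Sigma_class T \<alpha>"
proof (cases "\<forall>\<beta>. \<alpha> \<le> \<beta>")
  case True
  then show ?thesis
    using G by (simp add: Sigma_class_zero)
next
  case False
  obtain \<zeta> :: countable_ordinal where \<zeta>: "\<And>\<beta>. \<zeta> \<le> \<beta>"
    by (rule countable_ordinal_zero) blast
  then have less: "\<zeta> < \<alpha>"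
    using False by (meson leD leI order_trans)
  \<comment> \<open>The complement of \<open>G\<close> is G-delta, so \<open>G\<close> is a
    countable union of closed sets. These have multiplicative class \<zeta>, which is 0 and lies
    below \<alpha>.\<close>
  have "fsigma_in T G"
    using gdelta[of "topspace T - G"] G by (simp add: fsigma_in_gdelta_in openin_subset openin_closedin_eq)
  then obtain C where C: "\<And>n :: nat. closedin T (C n)" "G = (\<Union>n. C n)"
    unfolding fsigma_in_ascending by blast
  have "C n \<in> Pi_class T \<zeta>" for n
    using C(1)[of n] unfolding Pi_class_def Sigma_class_zero[OF \<zeta>]
    by (auto intro!: exI[of _ "topspace T - C n"] dest: closedin_subset)
  then have "C n \<in> Sigma_class T \<alpha>" for n
    using Pi_class_subset_Sigma_class[OF less] by blast
  then show ?thesis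
    unfolding C(2) by (rule Sigma_class_UN_nat)
qed

text \<open>Above class 0, a larger index only enlarges the stock of multiplicative sets that may be
  united. The G-delta condition enters at class 0, where an open set has to be written as a union of
  closed sets.\<close>

lemma Sigma_class_mono:
  assumes gdelta: "\<And>C. closedin T C \<Longrightarrow> gdelta_in T C" and "\<alpha> \<le> \<beta>"
  shows "Sigma_class T \<alpha> \<subseteq> Sigma_class T \<beta>"
proof (cases "\<forall>\<gamma>. \<alpha> \<le> \<gamma>")
  case True
  then show ?thesis
    using open_in_Sigma_class[OF gdelta] by (auto simp: Sigma_class_zero)
next
  case False
  then obtain \<gamma> where \<gamma>: "\<gamma> < \<alpha>"
    using not_less by blast
  then have \<beta>: "\<gamma> < \<beta>"
    using assms(2) by simp
  have "{..<\<alpha>} \<subseteq> {..<\<beta>}"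
    using assms(2) by simp
  then show ?thesis
    unfolding Sigma_class_pos[OF \<gamma>] Sigma_class_pos[OF \<beta>]
    by (intro Collect_mono ex_mono impI conjI allI) (meson UN_iff subsetD)+
qed

lemma Pi_class_mono:
  assumes "\<And>C. closedin T C \<Longrightarrow> gdelta_in T C" and "\<alpha> \<le> \<beta>"
  shows "Pi_class T \<alpha> \<subseteq> Pi_class T \<beta>"
  using Sigma_class_mono[OF assms] unfolding Pi_class_def by blast

text \<open>Monotonicity of the classes is used in the target spaces only, so \<open>T\<close> itself (a product below)
  need not be perfect.\<close>

lemma Sigma_class_Int_preimage:
  assumes gdelta: "\<And>C. closedin T1 C \<Longrightarrow> gdelta_in T1 C" "\<And>C. closedin T2 C \<Longrightarrow> gdelta_in T2 C"
    and cont: "continuous_map T T1 f" "continuous_map T T2 g"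
    and AB: "A \<in> Sigma_class T1 \<alpha>" "B \<in> Sigma_class T2 \<alpha>"
  shows "{x \<in> topspace T. f x \<in> A \<and> g x \<in> B} \<in> Sigma_class T \<alpha>"
proof (cases "\<forall>\<beta>. \<alpha> \<le> \<beta>")
  case True
  have "{x \<in> topspace T. f x \<in> A \<and> g x \<in> B} =
      {x \<in> topspace T. f x \<in> A} \<inter> {x \<in> topspace T. g x \<in> B}"
    by blast
  then show ?thesis
    using AB cont True by (simp add: Sigma_class_zero openin_Int openin_continuous_map_preimage)
next
  case False
  then obtain \<gamma> where \<gamma>: "\<gamma> < \<alpha>"
    using not_less by blast
  obtain A' where A': "A = (\<Union>n. A' n)" "\<And>n :: nat. A' n \<in> (\<Union>\<beta>\<in>{..<\<alpha>}. Pi_class T1 \<beta>)"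
    using AB(1) unfolding Sigma_class_pos[OF \<gamma>] by blast
  obtain B' where B': "B = (\<Union>n. B' n)" "\<And>n :: nat. B' n \<in> (\<Union>\<beta>\<in>{..<\<alpha>}. Pi_class T2 \<beta>)"
    using AB(2) unfolding Sigma_class_pos[OF \<gamma>] by blast
  have "{x \<in> topspace T. f x \<in> A' i \<and> g x \<in> B' j} \<in> Sigma_class T \<alpha>" for i j
  proof -
    obtain \<beta>1 \<beta>2 where \<beta>: "\<beta>1 < \<alpha>" "A' i \<in> Pi_class T1 \<beta>1" "\<beta>2 < \<alpha>" "B' j \<in> Pi_class T2 \<beta>2"
      using A'(2)[of i] B'(2)[of j] by auto
    \<comment> \<open>The two sets may sit at different levels. Both are raised to the larger one,
      which is still below \<alpha>, so that the preimages can be intersected within one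
      multiplicative class.\<close>
    define \<delta> where "\<delta> = max \<beta>1 \<beta>2"
    have "A' i \<in> Pi_class T1 \<delta>" "B' j \<in> Pi_class T2 \<delta>"
      using \<beta> Pi_class_mono[OF gdelta(1), of \<beta>1 \<delta>] Pi_class_mono[OF gdelta(2), of \<beta>2 \<delta>]
      by (auto simp: \<delta>_def)
    then have "{x \<in> topspace T. f x \<in> A' i} \<inter> {x \<in> topspace T. g x \<in> B' j} \<in> Pi_class T \<delta>"
      by (intro Pi_class_Int Pi_class_preimage[OF cont(1)] Pi_class_preimage[OF cont(2)])
    moreover have "{x \<in> topspace T. f x \<in> A' i} \<inter> {x \<in> topspace T. g x \<in> B' j} =
        {x \<in> topspace T. f x \<in> A' i \<and> g x \<in> B' j}"
      by blast
    moreover have "\<delta> < \<alpha>"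
      using \<beta> by (simp add: \<delta>_def)
    ultimately show ?thesis
      using Pi_class_subset_Sigma_class[of \<delta> \<alpha> T] by auto
  qed
  then have "(\<Union>i. \<Union>j. {x \<in> topspace T. f x \<in> A' i \<and> g x \<in> B' j}) \<in> Sigma_class T \<alpha>"
    by (rule Sigma_class_UN_nat[OF Sigma_class_UN_nat])
  moreover have "(\<Union>i. \<Union>j. {x \<in> topspace T. f x \<in> A' i \<and> g x \<in> B' j}) =
      {x \<in> topspace T. f x \<in> A \<and> g x \<in> B}"
    unfolding A'(1) B'(1) by blast
  ultimately show ?thesis
    by simp
qed

text \<open>A rectangle is the intersection of the preimages of its sides under the two
  projections.\<close>

lemma Sigma_class_Times:
  assumes "\<And>C. closedin T1 C \<Longrightarrow> gdelta_in T1 C" and "\<And>C. closedin T2 C \<Longrightarrow> gdelta_in T2 C"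
    and A: "A \<in> Sigma_class T1 \<alpha>" and B: "B \<in> Sigma_class T2 \<alpha>"
  shows "A \<times> B \<in> Sigma_class (prod_topology T1 T2) \<alpha>"
proof -
  have "{p \<in> topspace (prod_topology T1 T2). fst p \<in> A \<and> snd p \<in> B} = A \<times> B"
    using A[THEN Sigma_class_subset_topspace] B[THEN Sigma_class_subset_topspace] by auto
  then show ?thesis
    using Sigma_class_Int_preimage[OF assms(1,2) continuous_map_fst continuous_map_snd A B] by simp
qed

lemma Sigma_class_Int:
  assumes "\<And>C. closedin T C \<Longrightarrow> gdelta_in T C"
    and A: "A \<in> Sigma_class T \<alpha>" and B: "B \<in> Sigma_class T \<alpha>"
  shows "A \<inter> B \<in> Sigma_class T \<alpha>"
proof -
  have "{x \<in> topspace T. x \<in> A \<and> x \<in> B} = A \<inter> B"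
    using A[THEN Sigma_class_subset_topspace] by auto
  then show ?thesis
    using Sigma_class_Int_preimage[OF assms(1,1) continuous_map_id continuous_map_id A B] by simp
qed

section \<open>Closed sets in perfectly normal spaces\<close>

lemma perfectly_normal_closed_eq_Inter:
  assumes "perfectly_normal_space Z" and "closedin Z K"
  obtains V :: "nat \<Rightarrow> 'z set" where "\<And>n. openin Z (V n)" and "\<And>n. K \<subseteq> V n" and "decseq V"
    and "(\<Inter>n. Z closure_of V n) = K"
proof -
  have norm: "normal_space Z" and "gdelta_in Z K"
    using assms by (auto simp: perfectly_normal_space_def)
  then obtain C where C: "\<And>n :: nat. openin Z (C n)" "\<Inter>(range C) = K"
    unfolding gdelta_in_descending by blast
  \<comment> \<open>Normality inserts an open set and its closure between \<open>K\<close> and each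
    member of the G-delta representation, so the closures still intersect in
    \<open>K\<close>.\<close>
  have "\<exists>W. openin Z W \<and> K \<subseteq> W \<and> Z closure_of W \<subseteq> C n" for n
    using norm assms(2) C unfolding normal_space_alt by blast
  then obtain W where W: "\<And>n. openin Z (W n)" "\<And>n. K \<subseteq> W n" "\<And>n. Z closure_of W n \<subseteq> C n"
    by metis
  \<comment> \<open>Finite intersections make the sequence decreasing, so that in the theorem an
    index can be enlarged without leaving a given \<open>V m\<close>.\<close>
  define V where "V n = (\<Inter>i\<le>n. W i)" for n
  have "openin Z (V n)" for n
    unfolding V_def using W(1) by (intro openin_INT2) auto
  moreover have KV: "K \<subseteq> V n" for n
    unfolding V_def using W(2) by blast
  moreover have "decseq V"
    unfolding V_def decseq_def by fastforce
  moreover have "(\<Inter>n. Z closure_of V n) = K"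
  proof
    have "Z closure_of V n \<subseteq> C n" for n
      using closure_of_mono[of "V n" "W n" Z] W(3)[of n] unfolding V_def by blast
    then show "(\<Inter>n. Z closure_of V n) \<subseteq> K"
      using C(2) by blast
    show "K \<subseteq> (\<Inter>n. Z closure_of V n)"
      using closure_of_mono[OF KV] closure_of_closedin[OF assms(2)] by (metis INT_greatest)
  qed
  ultimately show ?thesis
    using that by blast
qed

section \<open>Countably many rectangles and the semicontinuity argument\<close>

theorem theorem1:
  fixes \<alpha> :: countable_ordinal
    and X :: "'x topology" and Z :: "'z topology"
    and Y :: "'y set" and d :: "'y \<Rightarrow> 'y \<Rightarrow> real" and TY :: "'y topology"
    and S :: "'y set" and U :: "'y \<Rightarrow> 'y set"
    and F :: "'x \<times> 'y \<Rightarrow> 'z set"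
  assumes "Metric_space Y d"
    and "perfectly_normal_space X" and "perfectly_normal_space Z"
    and "topspace TY = Y"
    and finer: "\<And>G. openin (Metric_space.mtopology Y d) G \<Longrightarrow> openin TY G"
    and "separable_space TY"
    and "countable S" and "S \<subseteq> Y" and "TY closure_of S = Y"
    and "\<And>v. v \<in> Y \<Longrightarrow> openin TY (U v)"
    and i: "\<And>y. y \<in> S \<Longrightarrow>
              {v \<in> Y. y \<in> U v} \<in> Sigma_class (Metric_space.mtopology Y d) \<alpha>"
    and ii: "\<And>v. v \<in> Y \<Longrightarrow>
              local_base TY v {U v \<inter> Metric_space.mball Y d v (1 / 2 ^ n) |n :: nat. n \<ge> 1}"
    and "multivalued (topspace X \<times> Y) (topspace Z) F"
    and "\<And>y. y \<in> Y \<Longrightarrow> upper_Borel_class X Z \<alpha> (\<lambda>x. F (x, y))"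
    and "\<And>x. x \<in> topspace X \<Longrightarrow> continuous_multi TY Z (\<lambda>y. F (x, y))"
  shows "lower_Borel_class (prod_topology X (Metric_space.mtopology Y d)) Z (ord_suc \<alpha>) F"
proof -
  interpret Y: Metric_space Y d
    by fact
  let ?M = "Y.mtopology" and ?P = "prod_topology X Y.mtopology"
  have gX: "gdelta_in X C" if "closedin X C" for C
    using that assms(2) by (simp add: perfectly_normal_space_def)
  have gY: "gdelta_in ?M C" if "closedin ?M C" for C
    using that Y.metrizable_space_mtopology closed_imp_gdelta_in by blast
  have "lower_inverse (topspace ?P) F G \<in> Sigma_class ?P (ord_suc \<alpha>)" if G: "openin Z G" for G
  proof -
    have "closedin Z (topspace Z - G)"
      using G by blast
    then obtain V :: "nat \<Rightarrow> 'z set" where V: "\<And>n. openin Z (V n)"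
      "\<And>n. topspace Z - G \<subseteq> V n" "decseq V" "(\<Inter>n. Z closure_of V n) = topspace Z - G"
      using perfectly_normal_closed_eq_Inter[OF assms(3)] by metis
    \<comment> \<open>The ball is centred at \<open>y\<close>: by symmetry of \<open>d\<close>,
      nearness of \<open>v\<close> and \<open>y\<close> becomes a condition on \<open>v\<close> for
      fixed \<open>y\<close>, and the second side is a set of class \<alpha> by
      \<open>i\<close>.\<close>
    define E where "E n y = upper_inverse (topspace X) (\<lambda>x. F (x, y)) (V n) \<times>
        ({v \<in> Y. y \<in> U v} \<inter> Y.mball y (1 / 2 ^ n))" for n y
    define H where "H n = (\<Union>y\<in>S. E n y)" for n
    have "E n y \<in> Sigma_class ?P \<alpha>" if "y \<in> S" for n y
      unfolding E_def
    proof (intro Sigma_class_Times Sigma_class_Int gX gY i that)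
      show "upper_inverse (topspace X) (\<lambda>x. F (x, y)) (V n) \<in> Sigma_class X \<alpha>"
        using assms(14)[of y] that assms(8) V(1) unfolding upper_Borel_class_def by blast
      show "Y.mball y (1 / 2 ^ n) \<in> Sigma_class ?M \<alpha>"
        using open_in_Sigma_class[OF gY] by blast
    qed
    then have H: "H n \<in> Sigma_class ?P \<alpha>" for n
      unfolding H_def using assms(7) by (intro Sigma_class_countable_UN)
    have HI: "F (x, v) \<inter> G = {} \<longleftrightarrow> (\<forall>n. (x, v) \<in> H n)" if x: "x \<in> topspace X" and v: "v \<in> Y" for x v
    proof
      have FZ: "F (x, v) \<subseteq> topspace Z"
        using assms(13) x v unfolding multivalued_def by blast
      have usc: "upper_semicontinuous TY Z (\<lambda>y. F (x, y))"
        and lsc: "lower_semicontinuous TY Z (\<lambda>y. F (x, y))"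
        using assms(15)[OF x] by (auto simp: continuous_multi_def)
      {
        assume "F (x, v) \<inter> G = {}"
        then have FV: "F (x, v) \<subseteq> V n" for n
          using FZ V(2) by blast
        show "\<forall>n. (x, v) \<in> H n"
        proof
          fix n
          \<comment> \<open>\<open>W\<close> collects all three conditions on \<open>y\<close>. It
            is \<open>TY\<close>-open and contains \<open>v\<close>, so the dense set
            \<open>S\<close> meets it.\<close>
          define W where "W = upper_inverse (topspace TY) (\<lambda>y. F (x, y)) (V n)
              \<inter> (U v \<inter> Y.mball v (1 / 2 ^ n))"
          have "openin TY W"
            unfolding W_def using usc V(1) assms(10)[OF v] finer[OF Y.openin_mball]
            by (intro openin_Int) (auto simp: upper_semicontinuous_def)
          moreover have "v \<in> U v"
          proof -
            \<comment> \<open>The index 1 is the first one allowed in \<open>ii\<close>; any member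
              of the local base would show that \<open>v\<close> lies in \<open>U v\<close>.\<close>
            have "nbhd TY v (U v \<inter> Y.mball v (1 / 2 ^ 1))"
              using ii[OF v] unfolding local_base_def by blast
            then show ?thesis
              by (auto simp: nbhd_def)
          qed
          then have "v \<in> W"
            using v FV assms(4) by (simp add: W_def upper_inverse_def)
          ultimately obtain y where "y \<in> S" "y \<in> W"
            using assms(4,9) dense_intersects_open[of TY S] by blast
          then show "(x, v) \<in> H n"
            using x v by (auto simp: H_def E_def W_def upper_inverse_def Y.commute)
        qed
      }
      {
        assume all: "\<forall>n. (x, v) \<in> H n"
        show "F (x, v) \<inter> G = {}"
        proof (rule ccontr)
          assume "F (x, v) \<inter> G \<noteq> {}"
          then obtain z where z: "z \<in> F (x, v)" "z \<in> G"
            by blast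
          then obtain m where m: "z \<notin> Z closure_of V m"
            using V(4) by blast
          \<comment> \<open>An open set around \<open>z\<close> that misses \<open>V m\<close>. By
            lower semicontinuity, \<open>F (x, y)\<close> meets it for all \<open>y\<close> in a
            \<open>TY\<close>-neighbourhood of \<open>v\<close>.\<close>
          define O' where "O' = topspace Z - Z closure_of V m"
          define W where "W = lower_inverse (topspace TY) (\<lambda>y. F (x, y)) O'"
          have "openin Z O'"
            unfolding O'_def by (rule openin_diff) simp_all
          then have "openin TY W"
            using lsc by (simp add: W_def lower_semicontinuous_def)
          moreover have "v \<in> W"
            using v z m FZ assms(4) by (auto simp: W_def O'_def lower_inverse_def)
          ultimately have "nbhd TY v W"
            by (auto simp: nbhd_def dest: openin_subset)
          then obtain k where k: "U v \<inter> Y.mball v (1 / 2 ^ k) \<subseteq> W"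
            using ii[OF v] unfolding local_base_def by blast
          \<comment> \<open>\<open>n \<ge> k\<close> puts \<open>y\<close> into the basic
            neighbourhood inside \<open>W\<close>, while \<open>n \<ge> m\<close> gives
            \<open>F (x, y) \<subseteq> V m\<close>; these two facts contradict each other.\<close>
          define n where "n = max k m"
          obtain y where y: "y \<in> S" "F (x, y) \<subseteq> V n" "y \<in> U v" "v \<in> Y.mball y (1 / 2 ^ n)"
            using all unfolding H_def E_def upper_inverse_def by blast
          have "(1 :: real) / 2 ^ n \<le> 1 / 2 ^ k"
            by (simp add: n_def field_simps)
          then have "y \<in> Y.mball v (1 / 2 ^ k)"
            using y(4) by (auto simp: Y.commute)
          then have "F (x, y) \<inter> O' \<noteq> {}"
            using y(3) k by (auto simp: W_def lower_inverse_def)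
          moreover have "F (x, y) \<subseteq> Z closure_of V m"
            using y(2) decseqD[OF V(3), of m n] closure_of_subset[OF openin_subset[OF V(1)[of m]]]
            by (auto simp: n_def)
          ultimately show False
            by (auto simp: O'_def)
        qed
      }
    qed
    \<comment> \<open>Negating \<open>HI\<close> turns the intersection of the \<open>H n\<close>
      into a union of complements. Each of these has multiplicative class \<alpha>, hence additive
      class \<open>ord_suc \<alpha>\<close>.\<close>
    have "lower_inverse (topspace ?P) F G = (\<Union>n. topspace ?P - H n)"
      using HI by (auto simp: lower_inverse_def)
    moreover have "topspace ?P - H n \<in> Sigma_class ?P (ord_suc \<alpha>)" for n
      using H[of n] Pi_class_subset_Sigma_class[OF less_ord_suc] unfolding Pi_class_def by blast
    ultimately show ?thesis
      by (simp only: Sigma_class_UN_nat)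
  qed
  then show ?thesis
    by (simp add: lower_Borel_class_def)
qed

end
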